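(* Let $\sigma>0$, $\epsilon\ge 0$, and let $(u^m_j)$ be a solution of any one of the three numerical schemes (MEC), (CN) or (LE) written out in the context, with the discretized multiplicative noise $g^{m+\frac12}_j=\epsilon\,\frac12\big(u^m_j+u^{m+1}_j\big)\,\tilde f^{\,m+\frac12}_j$ on the right-hand side. Then the scheme conserves the discrete mass, that is, $$M_{\mathrm{dis}}[u^{m+1}]=M_{\mathrm{dis}}[u^m],\qquad m=0,1,\dots,$$ where $M_{\mathrm{dis}}[u^m]=\frac12\sum_{j=0}^{N}|u^m_j|^2(\Delta x_j+\Delta x_{j-1})$.
   Context: Setting: numerical schemes for the 1D focusing stochastic nonlinear Schr\"odinger equation $iu_t+u_{xx}+|u|^{2\sigma}u=\epsilon f(u)$. Space grid: $x_0<x_1<\dots<x_N$ are real grid points in $[-L_c,L_c]$, not necessarily equidistributed, $\Delta x_j=x_{j+1}-x_j>0$; pseudo-points $x_{-1}$ and $x_{N+1}$ are added so that $\Delta x_{-1}=\Delta x_0$ and $\Delta x_N=\Delta x_{N-1}$. Time grid: $0=t_0<t_1<\cdots$ with $\Delta t_m=t_{m+1}-t_m>0$. The unknowns are complex numbers $u^m_j$ ($0\le j\le N$, $m\ge 0$), approximating $u(t_m,x_j)$. Discrete Neumann boundary conditions are imposed through the pseudo-point values $u^m_{-1}=u^m_0$ and $u^m_{N+1}=u^m_N$ for all $m$. Notation: $u^{m+\frac12}_j=\frac12(u^m_j+u^{m+1}_j)$, $V^m_j=|u^m_j|^{2\sigma}$, $V^{m+\frac12}_j=|u^{m+\frac12}_j|^{2\sigma}$,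 and $$\mathcal D_2 f_j=\frac{2}{\Delta x_{j-1}(\Delta x_{j-1}+\Delta x_j)}f_{j-1}-\frac{2}{\Delta x_{j-1}\Delta x_j}f_j+\frac{2}{(\Delta x_{j-1}+\Delta x_j)\Delta x_j}f_{j+1}.$$ Noise: $\chi^{m+\frac12}_j$ are independent real standard Gaussian random variables, and $\tilde f^{\,m+\frac12}_j$ are the real random variables $$\tilde f^{\,m+\frac12}_j=\frac{\sqrt3}{2}\,\frac{\sqrt{\Delta x_{j-1}}+\sqrt{\Delta x_j}}{\sqrt{\Delta t_m}\,(\Delta x_{j-1}+\Delta x_j)}\,\chi^{m+\frac12}_j\ (1\le j\le N-1),$$ $$\tilde f^{\,m+\frac12}_0=\frac{\sqrt3}{2}\frac{1}{\sqrt{\Delta t_m\Delta x_0}}\chi^{m+\frac12}_0,\qquad \tilde f^{\,m+\frac12}_N=\frac{\sqrt3}{2}\frac{1}{\sqrt{\Delta t_m\Delta x_N}}\chi^{m+\frac12}_N.$$ Schemes (each equation holds for all $0\le j\le N$ and all $m$ indicated): (MEC, mass-energy conservative), $m\ge0$: $$i\frac{u^{m+1}_j-u^m_j}{\Delta t_m}+\mathcal D_2u^{m+\frac12}_j+\frac{1}{\sigma+1}\,\frac{|u^{m+1}_j|^{2(\sigma+1)}-|u^m_j|^{2(\sigma+1)}}{|u^{m+1}_j|^2-|u^m_j|^2}\,u^{m+\frac12}_j=g^{m+\frac12}_j,$$ where the quotient is understood as its limiting value $(\sigma+1)|u^m_j|^{2\sigma}$ when $|u^{m+1}_j|=|u^m_j|$.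 (CN, Crank-Nicholson), $m\ge 0$: $$i\frac{u^{m+1}_j-u^m_j}{\Delta t_m}+\mathcal D_2u^{m+\frac12}_j+V^{m+\frac12}_ju^{m+\frac12}_j=g^{m+\frac12}_j.$$ (LE, linearized extrapolation), $m\ge1$: $$i\frac{u^{m+1}_j-u^m_j}{\Delta t_m}+\mathcal D_2u^{m+\frac12}_j+\frac12\Big(\frac{2\Delta t_{m-1}+\Delta t_m}{\Delta t_{m-1}}V^m_j-\frac{\Delta t_m}{\Delta t_{m-1}}V^{m-1}_j\Big)u^{m+\frac12}_j=g^{m+\frac12}_j,$$ with the first step $u^1$ computed from $u^0$ by (CN) or (MEC). *)

theory Defs
  imports "HOL-Probability.Probability"
begin

text \<open>Space indices are integers, so that the pseudo-points \<open>-1\<close> and \<open>N + 1\<close> are ordinary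
  indices; values of a grid function outside \<open>{-1..N + 1}\<close> are irrelevant. Time indices are
  naturals.\<close>

definition space_step :: "(int \<Rightarrow> real) \<Rightarrow> int \<Rightarrow> real" where
  "space_step x j = x (j + 1) - x j"

definition time_step :: "(nat \<Rightarrow> real) \<Rightarrow> nat \<Rightarrow> real" where
  "time_step t m = t (m + 1) - t m"

text \<open>Only the proper grid points are required to lie in \<open>[-L, L]\<close>, not the pseudo-points.\<close>

definition space_grid :: "real \<Rightarrow> int \<Rightarrow> (int \<Rightarrow> real) \<Rightarrow> bool" where
  "space_grid L N x \<longleftrightarrow>
     1 \<le> N \<and> x ` {0..N} \<subseteq> {-L..L} \<and> strict_mono_on {0..N} x \<and>
     space_step x (-1) = space_step x 0 \<and> space_step x N = space_step x (N - 1)"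

definition time_grid :: "(nat \<Rightarrow> real) \<Rightarrow> bool" where
  "time_grid t \<longleftrightarrow> t 0 = 0 \<and> strict_mono t"

definition neumann_bc :: "int \<Rightarrow> (nat \<Rightarrow> int \<Rightarrow> complex) \<Rightarrow> bool" where
  "neumann_bc N u \<longleftrightarrow> (\<forall>m. u m (-1) = u m 0 \<and> u m (N + 1) = u m N)"

definition D2 :: "(int \<Rightarrow> real) \<Rightarrow> (int \<Rightarrow> complex) \<Rightarrow> int \<Rightarrow> complex" where
  "D2 x f j =
     complex_of_real (2 / (space_step x (j - 1) * (space_step x (j - 1) + space_step x j))) * f (j - 1)
   - complex_of_real (2 / (space_step x (j - 1) * space_step x j)) * f j
   + complex_of_real (2 / ((space_step x (j - 1) + space_step x j) * space_step x j)) * f (j + 1)"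

definition midpoint_value :: "(nat \<Rightarrow> int \<Rightarrow> complex) \<Rightarrow> nat \<Rightarrow> int \<Rightarrow> complex" where
  "midpoint_value u m j = (u m j + u (m + 1) j) / 2"

definition potential :: "real \<Rightarrow> complex \<Rightarrow> real" where
  "potential \<sigma> z = cmod z powr (2 * \<sigma>)"

text \<open>The difference quotient of the energy nonlinearity between \<open>v = u\<^sup>m\<^sub>j\<close> and
  \<open>w = u\<^sup>m\<^sup>+\<^sup>1\<^sub>j\<close>, continued by its limiting value when the moduli coincide.\<close>

definition energy_quotient :: "real \<Rightarrow> complex \<Rightarrow> complex \<Rightarrow> real" where
  "energy_quotient \<sigma> v w =
     (if cmod w = cmod v then (\<sigma> + 1) * cmod v powr (2 * \<sigma>)
      else (cmod w powr (2 * (\<sigma> + 1)) - cmod v powr (2 * (\<sigma> + 1))) / ((cmod w)\<^sup>2 - (cmod v)\<^sup>2))"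

text \<open>One time step, from \<open>u\<^sup>m\<close> to \<open>u\<^sup>m\<^sup>+\<^sup>1\<close>, of each scheme, with right-hand side \<open>g\<close>;
  \<open>g m j\<close> stands for the value at time level \<open>m + 1/2\<close>.\<close>

definition MEC_step ::
  "real \<Rightarrow> int \<Rightarrow> (int \<Rightarrow> real) \<Rightarrow> (nat \<Rightarrow> real) \<Rightarrow> (nat \<Rightarrow> int \<Rightarrow> complex) \<Rightarrow>
    (nat \<Rightarrow> int \<Rightarrow> complex) \<Rightarrow> nat \<Rightarrow> bool" where
  "MEC_step \<sigma> N x t g u m \<longleftrightarrow>
     (\<forall>j\<in>{0..N}.
        \<i> * ((u (m + 1) j - u m j) / complex_of_real (time_step t m))
        + D2 x (midpoint_value u m) j
        + complex_of_real (1 / (\<sigma> + 1) * energy_quotient \<sigma> (u m j) (u (m + 1) j))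
            * midpoint_value u m j
        = g m j)"

definition CN_step ::
  "real \<Rightarrow> int \<Rightarrow> (int \<Rightarrow> real) \<Rightarrow> (nat \<Rightarrow> real) \<Rightarrow> (nat \<Rightarrow> int \<Rightarrow> complex) \<Rightarrow>
    (nat \<Rightarrow> int \<Rightarrow> complex) \<Rightarrow> nat \<Rightarrow> bool" where
  "CN_step \<sigma> N x t g u m \<longleftrightarrow>
     (\<forall>j\<in>{0..N}.
        \<i> * ((u (m + 1) j - u m j) / complex_of_real (time_step t m))
        + D2 x (midpoint_value u m) j
        + complex_of_real (potential \<sigma> (midpoint_value u m j)) * midpoint_value u m j
        = g m j)"

text \<open>A two-step scheme, meaningful only for \<open>m \<ge> 1\<close>.\<close>

definition LE_step ::
  "real \<Rightarrow> int \<Rightarrow> (int \<Rightarrow> real) \<Rightarrow> (nat \<Rightarrow> real) \<Rightarrow> (nat \<Rightarrow> int \<Rightarrow> complex) \<Rightarrow>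
    (nat \<Rightarrow> int \<Rightarrow> complex) \<Rightarrow> nat \<Rightarrow> bool" where
  "LE_step \<sigma> N x t g u m \<longleftrightarrow>
     (\<forall>j\<in>{0..N}.
        \<i> * ((u (m + 1) j - u m j) / complex_of_real (time_step t m))
        + D2 x (midpoint_value u m) j
        + complex_of_real (1 / 2 *
            ((2 * time_step t (m - 1) + time_step t m) / time_step t (m - 1) * potential \<sigma> (u m j)
             - time_step t m / time_step t (m - 1) * potential \<sigma> (u (m - 1) j)))
            * midpoint_value u m j
        = g m j)"

definition MEC_solution ::
  "real \<Rightarrow> int \<Rightarrow> (int \<Rightarrow> real) \<Rightarrow> (nat \<Rightarrow> real) \<Rightarrow> (nat \<Rightarrow> int \<Rightarrow> complex) \<Rightarrow>
    (nat \<Rightarrow> int \<Rightarrow> complex) \<Rightarrow> bool" where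
  "MEC_solution \<sigma> N x t g u \<longleftrightarrow> (\<forall>m. MEC_step \<sigma> N x t g u m)"

definition CN_solution ::
  "real \<Rightarrow> int \<Rightarrow> (int \<Rightarrow> real) \<Rightarrow> (nat \<Rightarrow> real) \<Rightarrow> (nat \<Rightarrow> int \<Rightarrow> complex) \<Rightarrow>
    (nat \<Rightarrow> int \<Rightarrow> complex) \<Rightarrow> bool" where
  "CN_solution \<sigma> N x t g u \<longleftrightarrow> (\<forall>m. CN_step \<sigma> N x t g u m)"

definition LE_solution ::
  "real \<Rightarrow> int \<Rightarrow> (int \<Rightarrow> real) \<Rightarrow> (nat \<Rightarrow> real) \<Rightarrow> (nat \<Rightarrow> int \<Rightarrow> complex) \<Rightarrow>
    (nat \<Rightarrow> int \<Rightarrow> complex) \<Rightarrow> bool" where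
  "LE_solution \<sigma> N x t g u \<longleftrightarrow>
     (CN_step \<sigma> N x t g u 0 \<or> MEC_step \<sigma> N x t g u 0) \<and> (\<forall>m\<ge>1. LE_step \<sigma> N x t g u m)"

definition iid_std_normal :: "'w measure \<Rightarrow> int \<Rightarrow> (nat \<Rightarrow> int \<Rightarrow> 'w \<Rightarrow> real) \<Rightarrow> bool" where
  "iid_std_normal P N chi \<longleftrightarrow>
     prob_space.indep_vars P (\<lambda>_. borel) (\<lambda>(m, j). chi m j) (UNIV \<times> {0..N}) \<and>
     (\<forall>m. \<forall>j\<in>{0..N}. distributed P lborel (chi m j) (\<lambda>y. ennreal (std_normal_density y)))"

definition discrete_noise ::
  "int \<Rightarrow> (int \<Rightarrow> real) \<Rightarrow> (nat \<Rightarrow> real) \<Rightarrow> (nat \<Rightarrow> int \<Rightarrow> 'w \<Rightarrow> real) \<Rightarrow> nat \<Rightarrow> int \<Rightarrow> 'w \<Rightarrow> real" where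
  "discrete_noise N x t chi m j \<omega> =
     (if j = 0 then sqrt 3 / 2 * (1 / sqrt (time_step t m * space_step x 0)) * chi m 0 \<omega>
      else if j = N then sqrt 3 / 2 * (1 / sqrt (time_step t m * space_step x N)) * chi m N \<omega>
      else sqrt 3 / 2 *
             ((sqrt (space_step x (j - 1)) + sqrt (space_step x j)) /
              (sqrt (time_step t m) * (space_step x (j - 1) + space_step x j))) * chi m j \<omega>)"

text \<open>The multiplicative noise term for a realised (real) noise \<open>f\<close>.\<close>

definition multiplicative_noise ::
  "real \<Rightarrow> (nat \<Rightarrow> int \<Rightarrow> real) \<Rightarrow> (nat \<Rightarrow> int \<Rightarrow> complex) \<Rightarrow> nat \<Rightarrow> int \<Rightarrow> complex" where
  "multiplicative_noise \<epsilon> f u m j =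
     complex_of_real \<epsilon> * (1 / 2 * (u m j + u (m + 1) j)) * complex_of_real (f m j)"

definition discrete_mass :: "int \<Rightarrow> (int \<Rightarrow> real) \<Rightarrow> (int \<Rightarrow> complex) \<Rightarrow> real" where
  "discrete_mass N x v =
     1 / 2 * (\<Sum>j=0..N. (cmod (v j))\<^sup>2 * (space_step x j + space_step x (j - 1)))"

end

theory Submission
  imports Defs
begin

text \<open>Each of the three schemes, noise included, has the form
  \<open>\<i> (w - v) / \<tau> + D\<^sub>2 h = r h\<close> with \<open>v\<close>, \<open>w\<close> the old and new values, \<open>h = (v + w) / 2\<close>
  their mean and \<open>r\<close> real: every nonlinearity, and also the noise, multiplies the mean \<open>h\<close> by a
  real number. A real potential only rotates the phase of \<open>h\<close>, so it cannot create or destroy mass,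
  and mass is conserved along each realisation of the noise separately.

  Multiply the equation by \<open>cnj h\<close> and take imaginary parts. The term \<open>r \<bar>h\<bar>\<^sup>2\<close> disappears, and
  since \<open>Re (cnj h (w - v)) = (\<bar>w\<bar>\<^sup>2 - \<bar>v\<bar>\<^sup>2) / 2\<close> the time difference becomes the
  change of \<open>\<bar>u\<bar>\<^sup>2\<close>. The mass weight \<open>x\<^sub>j\<^sub>+\<^sub>1 - x\<^sub>j\<^sub>-\<^sub>1\<close> cancels the factor that makes \<open>D\<^sub>2\<close>
  non-symmetric on a non-uniform grid, so what remains is the difference of the
  probability current through the two adjacent cells (\<open>mass_balance\<close>). This is a discrete
  continuity equation. Summed over the grid it telescopes to the currents through the two
  boundary cells, and these vanish because under the Neumann condition the two endpoints of such
  a cell carry the same value (\<open>discrete_mass_eq_of_real_potential\<close>).\<close>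

text \<open>The quantum-mechanical probability current \<open>Im (cnj h \<cdot> h')\<close> through the cell between the
  points \<open>j\<close> and \<open>j + 1\<close>, with the derivative replaced by the difference quotient: its second
  part \<open>cnj (h j) * h j\<close> is real and drops out.\<close>

definition current :: "(int \<Rightarrow> real) \<Rightarrow> (int \<Rightarrow> complex) \<Rightarrow> int \<Rightarrow> real" where
  "current x h j = Im (cnj (h j) * h (j + 1)) / space_step x j"

text \<open>Up to sign, the current is its own mirror image: \<open>cnj (h j) * h (j - 1)\<close> has the
  opposite imaginary part of \<open>cnj (h (j - 1)) * h j\<close>. Hence the two off-diagonal terms of the
  second difference give currents through neighbouring cells with opposite signs, while its
  diagonal term is real.\<close>

lemma Im_cnj_D2:
  assumes "space_step x (j - 1) > 0" and "space_step x j > 0"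
  shows "(space_step x j + space_step x (j - 1)) * Im (cnj (h j) * D2 x h j)
         = 2 * (current x h j - current x h (j - 1))"
proof -
  define a b where "a = space_step x (j - 1)" and "b = space_step x j"
  have pos: "a > 0" "b > 0"
    using assms by (simp_all add: a_def b_def)
  have diag: "Im (cnj (h j) * h j) = 0"
    by (simp add: mult.commute)
  have mirror: "Im (cnj (h j) * h (j - 1)) = - Im (cnj (h (j - 1)) * h j)"
    by simp
  have "cnj (h j) * D2 x h j =
      of_real (2 / (a * (a + b))) * (cnj (h j) * h (j - 1))
      - of_real (2 / (a * b)) * (cnj (h j) * h j)
      + of_real (2 / ((a + b) * b)) * (cnj (h j) * h (j + 1))"
    unfolding D2_def a_def b_def by (simp only: algebra_simps)
  then have "Im (cnj (h j) * D2 x h j) =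
      2 / ((a + b) * b) * Im (cnj (h j) * h (j + 1))
      - 2 / (a * (a + b)) * Im (cnj (h (j - 1)) * h j)"
    by (simp only: minus_complex.simps plus_complex.simps Im_complex_of_real
        Re_complex_of_real times_complex.simps(2)[of "of_real _"] mirror diag)
  moreover have "(b + a) * (2 / ((a + b) * b) * p - 2 / (a * (a + b)) * q) = 2 * (p / b - q / a)"
    for p q :: real
  proof -
    have "a + b \<noteq> 0" using pos by simp
    have "(b + a) * (2 / ((a + b) * b) * p) = 2 * (p / b)"
      using pos \<open>a + b \<noteq> 0\<close> by (simp add: divide_simps)
    moreover have "(b + a) * (2 / (a * (a + b)) * q) = 2 * (q / a)"
      using pos \<open>a + b \<noteq> 0\<close> by (simp add: divide_simps)
    ultimately show ?thesis by (simp only: right_diff_distrib)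
  qed
  ultimately show ?thesis
    by (simp only: current_def a_def[symmetric] b_def[symmetric] diff_add_cancel)
qed

text \<open>The polarisation behind every midpoint rule: the increment of a square is the product of
  the increment with twice the mean.\<close>

lemma Re_cnj_mean_times_increment:
  "Re (cnj ((v + w) / 2) * (w - v)) = ((cmod w)\<^sup>2 - (cmod v)\<^sup>2) / 2"
  unfolding cmod_power2 by (simp add: power2_eq_square field_simps)

text \<open>In the imaginary part of the equation multiplied by \<open>cnj h\<close>, the time difference gives
  the change of mass and the second difference gives the net outflow, while the real factor \<open>r\<close>
  contributes the real number \<open>r \<bar>h\<bar>\<^sup>2\<close>.\<close>

lemma mass_balance:
  assumes "\<tau> > 0" and "space_step x (j - 1) > 0" and "space_step x j > 0"
    and mean: "h j = (v + w) / 2"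
    and eq: "\<i> * ((w - v) / of_real \<tau>) + D2 x h j = of_real r * h j"
  shows "((cmod w)\<^sup>2 - (cmod v)\<^sup>2) * (space_step x j + space_step x (j - 1))
         = 4 * \<tau> * (current x h (j - 1) - current x h j)"
proof -
  have "cnj (h j) * (\<i> * ((w - v) / of_real \<tau>) + D2 x h j) = cnj (h j) * (of_real r * h j)"
    using eq by simp
  then have "\<i> * (cnj (h j) * (w - v)) / of_real \<tau> + cnj (h j) * D2 x h j
      = of_real r * (cnj (h j) * h j)"
    by (simp add: algebra_simps)
  then have "Im (\<i> * (cnj (h j) * (w - v)) / of_real \<tau>) + Im (cnj (h j) * D2 x h j)
      = Im (of_real r * (cnj (h j) * h j))"
    by (metis plus_complex.simps(2))
  moreover have "Im (of_real r * (cnj (h j) * h j)) = 0"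
    by (simp add: mult.commute)
  moreover have "Im (\<i> * (cnj (h j) * (w - v)) / of_real \<tau>) = ((cmod w)\<^sup>2 - (cmod v)\<^sup>2) / 2 / \<tau>"
    unfolding Im_divide_of_real Im_i_times mean Re_cnj_mean_times_increment ..
  ultimately have "((cmod w)\<^sup>2 - (cmod v)\<^sup>2) / 2 / \<tau> + Im (cnj (h j) * D2 x h j) = 0"
    by (simp only:)
  moreover have "p = - 2 * \<tau> * q" if "p / 2 / \<tau> + q = 0" for p q
    using that \<open>\<tau> > 0\<close> by (simp add: field_simps)
  ultimately have "(cmod w)\<^sup>2 - (cmod v)\<^sup>2 = - 2 * \<tau> * Im (cnj (h j) * D2 x h j)"
    by blast
  then have "((cmod w)\<^sup>2 - (cmod v)\<^sup>2) * (space_step x j + space_step x (j - 1))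
      = - 2 * \<tau> * ((space_step x j + space_step x (j - 1)) * Im (cnj (h j) * D2 x h j))"
    by simp
  also have "\<dots> = 4 * \<tau> * (current x h (j - 1) - current x h j)"
    unfolding Im_cnj_D2[OF assms(2,3)] by (simp add: algebra_simps)
  finally show ?thesis .
qed

lemma sum_telescope_int:
  fixes f :: "int \<Rightarrow> 'a::ab_group_add"
  assumes "a \<le> b"
  shows "(\<Sum>j=a..b. f (j - 1) - f j) = f (a - 1) - f b"
  using assms
proof (induction b rule: int_ge_induct)
  case base
  show ?case by simp
next
  case (step b)
  then have "{a..b + 1} = insert (b + 1) {a..b}" by auto
  then show ?case using step by simp
qed

lemma space_step_pos:
  assumes grid: "space_grid L N x" and j: "j \<in> {-1..N}"
  shows "space_step x j > 0"
proof -
  have N: "1 \<le> N" and mono: "strict_mono_on {0..N} x"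
    and ends: "space_step x (-1) = space_step x 0" "space_step x N = space_step x (N - 1)"
    using grid by (simp_all add: space_grid_def)
  have inner: "space_step x k > 0" if "k \<in> {0..N - 1}" for k
    using that strict_mono_onD[OF mono, of k "k + 1"] by (simp add: space_step_def)
  consider "j = -1" | "j \<in> {0..N - 1}" | "j = N" using j by force
  then show ?thesis using inner N ends by cases auto
qed

lemma time_step_pos: "time_grid t \<Longrightarrow> time_step t m > 0"
  by (simp add: time_grid_def time_step_def strict_mono_def)

text \<open>The real factor \<open>r\<close> may depend on the solution itself, which covers nonlinear equations.\<close>

lemma discrete_mass_eq_of_real_potential:
  assumes grid: "space_grid L N x" and "time_grid t" and bc: "neumann_bc N u"
    and eq: "\<And>j. j \<in> {0..N} \<Longrightarrow>
      \<i> * ((u (m + 1) j - u m j) / of_real (time_step t m)) + D2 x (midpoint_value u m) j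
      = of_real (r j) * midpoint_value u m j"
  shows "discrete_mass N x (u (m + 1)) = discrete_mass N x (u m)"
proof -
  define h where "h = midpoint_value u m"
  define \<tau> where "\<tau> = time_step t m"
  have "0 \<le> N" using grid by (simp add: space_grid_def)
  have "h (-1) = h 0" and "h (N + 1) = h N"
    using bc by (simp_all add: h_def midpoint_value_def neumann_bc_def)
  then have no_flux: "current x h (-1) = 0" "current x h N = 0"
    by (simp_all add: current_def mult.commute)
  have "((cmod (u (m + 1) j))\<^sup>2 - (cmod (u m j))\<^sup>2) * (space_step x j + space_step x (j - 1))
      = 4 * \<tau> * (current x h (j - 1) - current x h j)" if "j \<in> {0..N}" for j
    using that eq[OF that] time_step_pos[OF \<open>time_grid t\<close>]
    by (intro mass_balance[where r = "r j"] space_step_pos[OF grid])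
      (simp_all add: h_def \<tau>_def midpoint_value_def[of u m j])
  then have "(\<Sum>j=0..N. ((cmod (u (m + 1) j))\<^sup>2 - (cmod (u m j))\<^sup>2)
        * (space_step x j + space_step x (j - 1)))
      = 4 * \<tau> * (\<Sum>j=0..N. current x h (j - 1) - current x h j)"
    unfolding sum_distrib_left by (rule sum.cong[OF refl])
  also have "\<dots> = 0"
    using no_flux by (simp add: sum_telescope_int[OF \<open>0 \<le> N\<close>])
  finally show ?thesis
    by (simp add: discrete_mass_def left_diff_distrib sum_subtractf)
qed

lemma multiplicative_noise_midpoint:
  "multiplicative_noise \<epsilon> f u m j = of_real (\<epsilon> * f m j) * midpoint_value u m j"
  by (simp add: multiplicative_noise_def midpoint_value_def)

text \<open>Moving the potential term to the right-hand side brings each scheme into the common form.\<close>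

lemma discrete_mass_eq_of_step:
  fixes \<sigma> \<epsilon> :: real and f :: "nat \<Rightarrow> int \<Rightarrow> real"
  defines "g u \<equiv> multiplicative_noise \<epsilon> f u"
  assumes "space_grid L N x" and "time_grid t" and "neumann_bc N u"
    and step: "MEC_step \<sigma> N x t (g u) u m \<or> CN_step \<sigma> N x t (g u) u m \<or> LE_step \<sigma> N x t (g u) u m"
  shows "discrete_mass N x (u (m + 1)) = discrete_mass N x (u m)"
proof -
  have collect: "A + B = of_real (q - p) * z"
    if "A + B + of_real p * z = of_real q * z" for A B z :: complex and p q :: real
    using that by (simp add: algebra_simps)
  note conserved = discrete_mass_eq_of_real_potential[OF assms(2-4)]
  consider "MEC_step \<sigma> N x t (g u) u m" | "CN_step \<sigma> N x t (g u) u m" | "LE_step \<sigma> N x t (g u) u m"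
    using step by blast
  then show ?thesis
  proof cases
    case 1
    then show ?thesis
      unfolding MEC_step_def g_def multiplicative_noise_midpoint
      by - (rule conserved, rule collect, drule (1) bspec, assumption)
  next
    case 2
    then show ?thesis
      unfolding CN_step_def g_def multiplicative_noise_midpoint
      by - (rule conserved, rule collect, drule (1) bspec, assumption)
  next
    case 3
    then show ?thesis
      unfolding LE_step_def g_def multiplicative_noise_midpoint
      by - (rule conserved, rule collect, drule (1) bspec, assumption)
  qed
qed

theorem lemma3p1:
  fixes \<sigma> \<epsilon> L :: real and N :: int
    and x :: "int \<Rightarrow> real" and t :: "nat \<Rightarrow> real"
    and P :: "'w measure" and chi :: "nat \<Rightarrow> int \<Rightarrow> 'w \<Rightarrow> real"
    and u :: "'w \<Rightarrow> nat \<Rightarrow> int \<Rightarrow> complex" and g :: "'w \<Rightarrow> nat \<Rightarrow> int \<Rightarrow> complex"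
    and \<omega> :: 'w
  assumes "\<sigma> > 0" and "\<epsilon> \<ge> 0"
    and "space_grid L N x" and "time_grid t"
    and "prob_space P" and "iid_std_normal P N chi"
    and "\<omega> \<in> space P"
    and "neumann_bc N (u \<omega>)"
    and "g \<omega> = multiplicative_noise \<epsilon> (\<lambda>m j. discrete_noise N x t chi m j \<omega>) (u \<omega>)"
    and "MEC_solution \<sigma> N x t (g \<omega>) (u \<omega>) \<or> CN_solution \<sigma> N x t (g \<omega>) (u \<omega>)
         \<or> LE_solution \<sigma> N x t (g \<omega>) (u \<omega>)"
  shows "\<forall>m. discrete_mass N x (u \<omega> (m + 1)) = discrete_mass N x (u \<omega> m)"
proof
  fix m
  let ?g = "multiplicative_noise \<epsilon> (\<lambda>m j. discrete_noise N x t chi m j \<omega>) (u \<omega>)"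
  have "MEC_step \<sigma> N x t ?g (u \<omega>) m \<or> CN_step \<sigma> N x t ?g (u \<omega>) m \<or> LE_step \<sigma> N x t ?g (u \<omega>) m"
    using assms(9,10) unfolding MEC_solution_def CN_solution_def LE_solution_def
    by (cases "m = 0") auto
  then show "discrete_mass N x (u \<omega> (m + 1)) = discrete_mass N x (u \<omega> m)"
    by (rule discrete_mass_eq_of_step[OF assms(3,4,8)])
qed

end
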